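(* For every positive integer $n$ there exists a cubefree binary word of the form $ww$ with $|ww| = 2n$ (i.e., a cubefree binary square of length $2n$).
   Context: A square is a non-empty word of the form $xx$; a cube is a non-empty word of the form $xxx$. A word is cubefree if none of its factors (contiguous subwords) is a cube. A binary word is a word over a two-letter alphabet, e.g. $\{0,1\}$. *)

theory Defs
  imports "HOL-Library.Sublist"
begin

definition is_square :: "'a list \<Rightarrow> bool" where
  "is_square w \<longleftrightarrow> (\<exists>x. x \<noteq> [] \<and> w = x @ x)"

definition is_cube :: "'a list \<Rightarrow> bool" where
  "is_cube w \<longleftrightarrow> (\<exists>x. x \<noteq> [] \<and> w = x @ x @ x)"

text \<open>
  Factors are contiguous subwords, which is the relation \<^const>\<open>sublist\<close>
  (as opposed to \<^const>\<open>subseq\<close>, which allows gaps).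
\<close>

definition cubefree :: "'a list \<Rightarrow> bool" where
  "cubefree w \<longleftrightarrow> (\<forall>u. sublist u w \<longrightarrow> \<not> is_cube u)"

end

theory Submission
  imports Defs
begin

text \<open>
  Take \<open>w = p @ u\<close>, where \<open>u\<close> is the prefix of length \<open>n - 7\<close> of the Thue--Morse word and \<open>p\<close> is a
  word of length 7 that is not a factor of the Thue--Morse word.  A cube in \<open>ww\<close> of period at
  least 7 cannot contain an occurrence of \<open>p\<close>, since shifting by the period would produce a
  second occurrence at a distance different from \<open>n\<close>; so it lies in \<open>u\<close> up to 6 letters on each side, and
  \<open>u\<close> contains more than two periods of it, contradicting overlap-freeness of the Thue--Morse
  word.  Cubes of period at most 6, and further occurrences of \<open>p\<close>, can be seen in the
  window consisting of \<open>p\<close> and the 17 letters on both sides.  There are only 48 possible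
  left contexts, and for each of them one of four words \<open>p\<close> works.
  This needs \<open>n \<ge> 32\<close>; for smaller \<open>n\<close> one of these words, or the empty one, also works.
\<close>

section \<open>The Thue--Morse word\<close>

fun thue_morse :: "nat \<Rightarrow> bool" where
  "thue_morse n = (if n = 0 then False else odd n \<noteq> thue_morse (n div 2))"

declare thue_morse.simps [simp del]

lemma thue_morse_double [simp]: "thue_morse (2 * n) = thue_morse n"
  by (cases "n = 0") (simp_all add: thue_morse.simps [of "2 * n"])

lemma thue_morse_double_Suc [simp]: "thue_morse (Suc (2 * n)) = (\<not> thue_morse n)"
  by (simp add: thue_morse.simps [of "Suc (2 * n)"])

text \<open>Induction on the period. If p is even, every second letter reads off an overlap of half
  the period, as even positions copy the word and odd ones negate it. If p is odd, one of i + j and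
  i + j + p is even, and an even position differs from its successor; so the block alternates and a
  shift by p flips its letters.\<close>

lemma thue_morse_overlap_free:
  assumes "p > 0" and "\<And>j. j \<le> p \<Longrightarrow> thue_morse (i + j) = thue_morse (i + j + p)"
  shows False
  using assms
proof (induction p arbitrary: i rule: less_induct)
  case (less p)
  show ?case
  proof (cases "even p")
    case True
    then obtain q where q: "p = 2 * q" by blast
    have "thue_morse (i div 2 + j) = thue_morse (i div 2 + j + q)" if "j \<le> q" for j
    proof (cases "even i")
      case True
      then have "i + 2 * j = 2 * (i div 2 + j)" "i + 2 * j + p = 2 * (i div 2 + j + q)"
        using q by auto
      then show ?thesis
        using less.prems(2) [of "2 * j"] that q by (metis mult_le_mono2 thue_morse_double)
    next
      case False
      then have "i + 2 * j = Suc (2 * (i div 2 + j))"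
        "i + 2 * j + p = Suc (2 * (i div 2 + j + q))"
        using q by (auto elim!: oddE)
      then show ?thesis
        using less.prems(2) [of "2 * j"] that q by (metis mult_le_mono2 thue_morse_double_Suc)
    qed
    then show ?thesis
      using less.IH [of q "i div 2"] less.prems(1) q by simp
  next
    case False
    have alternating: "thue_morse (i + Suc j) = (\<not> thue_morse (i + j))" if "j < p" for j
    proof (cases "even (i + j)")
      case True
      then obtain k where "i + j = 2 * k" by blast
      then show ?thesis by simp
    next
      case odd: False
      then obtain k where "i + j + p = 2 * k" using \<open>odd p\<close> by (meson evenE odd_even_add)
      then have "thue_morse (i + j + p) = (\<not> thue_morse (i + Suc j + p))" by simp
      then show ?thesis
        using less.prems(2) [of j] less.prems(2) [of "Suc j"] that by simp
    qed
    have "thue_morse (i + j) = (thue_morse i \<noteq> odd j)" if "j \<le> p" for j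
      using that
    proof (induction j)
      case (Suc j)
      then show ?case using alternating [of j] by auto
    qed simp
    from this [of p] show ?thesis
      using less.prems(2) [of 0] False by simp
  qed
qed

section \<open>Factors of the Thue--Morse word\<close>

definition tm_factor :: "nat \<Rightarrow> nat \<Rightarrow> bool list" where
  "tm_factor i k = map (\<lambda>j. thue_morse (i + j)) [0..<k]"

text \<open>The Thue--Morse morphism; \<open>morphism_tm_factor\<close> says that the word is its
  fixed point.\<close>

fun morphism :: "bool list \<Rightarrow> bool list" where
  "morphism [] = []"
| "morphism (b # bs) = b # (\<not> b) # morphism bs"

lemma length_tm_factor [simp]: "length (tm_factor i k) = k"
  by (simp add: tm_factor_def)

lemma nth_tm_factor [simp]: "j < k \<Longrightarrow> tm_factor i k ! j = thue_morse (i + j)"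
  by (simp add: tm_factor_def)

lemma take_tm_factor: "j \<le> k \<Longrightarrow> take j (tm_factor i k) = tm_factor i j"
  by (simp add: tm_factor_def take_map)

lemma tm_factor_Suc: "tm_factor i (Suc k) = thue_morse i # tm_factor (Suc i) k"
  unfolding tm_factor_def upt_conv_Cons [OF zero_less_Suc] map_Suc_upt [symmetric] by simp

lemma morphism_tm_factor: "morphism (tm_factor i k) = tm_factor (2 * i) (2 * k)"
proof (induction k arbitrary: i)
  case 0
  show ?case by (simp add: tm_factor_def)
next
  case (Suc k)
  then show ?case using Suc [of "Suc i"] by (simp add: tm_factor_Suc)
qed

text \<open>A factor of length \<open>2k + 1\<close> is the image of a factor of length \<open>k + 1\<close> without its first or last letter.\<close>

fun refine :: "bool list list \<Rightarrow> bool list list" where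
  "refine [] = []"
| "refine (v # vs) = butlast (morphism v) # tl (morphism v) # refine vs"

lemma set_refine:
  "set (refine vs) =
    (\<lambda>v. butlast (morphism v)) ` set vs \<union> (\<lambda>v. tl (morphism v)) ` set vs"
  by (induction vs) auto

lemma tm_factor_refine:
  assumes "\<And>i. tm_factor i (Suc k) \<in> set vs"
  shows "tm_factor i (Suc (2 * k)) \<in> set (refine vs)"
proof -
  let ?v = "tm_factor (i div 2) (Suc k)"
  have m: "morphism ?v = tm_factor (2 * (i div 2)) (Suc (Suc (2 * k)))"
    by (simp add: morphism_tm_factor)
  show ?thesis
  proof (cases "even i")
    case True
    then have "tm_factor i (Suc (2 * k)) = butlast (morphism ?v)"
      unfolding m butlast_conv_take by (simp add: take_tm_factor)
    then show ?thesis using assms [of "i div 2"] by (auto simp: set_refine)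
  next
    case False
    then have "tm_factor i (Suc (2 * k)) = tl (morphism ?v)"
      unfolding m by (subst tm_factor_Suc) simp
    then show ?thesis using assms [of "i div 2"] by (auto simp: set_refine)
  qed
qed

text \<open>The lengths run 2, 3, 5, 9, 17. Repetitions are kept: 64 entries, 48 distinct
  words.\<close>

definition factors17 :: "bool list list" where
  "factors17 = refine (refine (refine (refine [[False, False], [False, True], [True, False], [True, True]])))"

lemma tm_factor_17: "tm_factor i 17 \<in> set factors17"
proof -
  let ?F2 = "[[False, False], [False, True], [True, False], [True, True]]"
  have "tm_factor i (Suc 1) \<in> set ?F2" for i
    by (auto simp: tm_factor_def)
  from tm_factor_refine [OF this]
  have "tm_factor i (Suc 2) \<in> set (refine ?F2)" for i
    by (simp only: mult_1_right)
  from tm_factor_refine [OF this]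
  have "tm_factor i (Suc 4) \<in> set (refine (refine ?F2))" for i
    by (simp del: refine.simps)
  from tm_factor_refine [OF this]
  have "tm_factor i (Suc 8) \<in> set (refine (refine (refine ?F2)))" for i
    by (simp del: refine.simps)
  from tm_factor_refine [OF this]
  show ?thesis
    by (simp del: refine.simps add: factors17_def)
qed

section \<open>Finite checks\<close>

text \<open>
  The checks use \<open>if\<close> instead of conjunction because rewriting does not evaluate
  the branches of \<open>if\<close> before its condition.
\<close>

fun agree :: "nat \<Rightarrow> bool list \<Rightarrow> bool list \<Rightarrow> bool" where
  "agree 0 xs ys = True"
| "agree (Suc k) (x # xs) (y # ys) = (if x = y then agree k xs ys else False)"
| "agree (Suc k) xs ys = False"

text \<open>A cube of period x is a block of 3x letters whose first 2x agree with those x places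
  later. \<open>agree\<close> fails on lists that are too short, so nothing is reported past the
  end.\<close>

fun avoids_cubes :: "nat \<Rightarrow> bool list \<Rightarrow> bool" where
  "avoids_cubes x [] = True"
| "avoids_cubes x (b # bs) =
    (if agree (2 * x) (b # bs) (drop x (b # bs)) then False else avoids_cubes x bs)"

fun avoids_word :: "bool list \<Rightarrow> bool list \<Rightarrow> bool" where
  "avoids_word p [] = True"
| "avoids_word p (b # bs) =
    (if agree (length p) p (b # bs) then False else avoids_word p bs)"

lemma agree_iff:
  "agree k xs ys \<longleftrightarrow> k \<le> length xs \<and> k \<le> length ys \<and> (\<forall>j<k. xs ! j = ys ! j)"
  by (induction k xs ys rule: agree.induct) (auto simp: less_Suc_eq_0_disj)

lemma avoids_cubesD:
  assumes "avoids_cubes x w" "x > 0" "i + 3 * x \<le> length w"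
  shows "\<exists>j<2 * x. w ! (i + j) \<noteq> w ! (i + j + x)"
  using assms
proof (induction x w arbitrary: i rule: avoids_cubes.induct)
  case (2 x b bs)
  show ?case
  proof (cases i)
    case 0
    then show ?thesis
      using "2.prems" by (auto simp: agree_iff add.commute split: if_splits)
  next
    case (Suc k)
    then show ?thesis
      using "2.IH" [of k] "2.prems" by (auto split: if_splits)
  qed
qed simp

lemma avoids_wordD:
  assumes "avoids_word p w" "p \<noteq> []" "i + length p \<le> length w"
  shows "\<exists>j<length p. w ! (i + j) \<noteq> p ! j"
  using assms
proof (induction p w arbitrary: i rule: avoids_word.induct)
  case (2 p b bs)
  show ?case
  proof (cases i)
    case 0
    then show ?thesis
      using "2.prems" by (auto simp: agree_iff split: if_splits)
  next
    case (Suc k)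
    then show ?thesis
      using "2.IH" [of k] "2.prems" by (auto split: if_splits)
  qed
qed simp

section \<open>The connecting words\<close>

definition connectors :: "bool list list" where
  "connectors =
    [[False, True, True, False, True, True, False], [False, False, True, False, False, True, True],
     [True, True, False, True, True, False, True], [False, True, False, True, False, False, True]]"

text \<open>Only the left context s varies with n. Dropping a letter of p hides its intended
  occurrence. A cube of period at most 6 has at most 18 letters, so if it meets p it reaches at most
  17 letters beyond.\<close>

definition fits :: "bool list \<Rightarrow> bool list \<Rightarrow> bool" where
  "fits s p \<longleftrightarrow>
     (if avoids_word p (s @ butlast p) then
        if avoids_word p (tl p @ tm_factor 0 17) then
          list_all (\<lambda>x. avoids_cubes x (s @ p @ tm_factor 0 17)) [1..<7]
        else False
      else False)"

lemma connector_fits: "list_all (\<lambda>s. list_ex (fits s) connectors) factors17"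
  by code_simp

text \<open>0110110, 1101101 and the prefix 01010 of 0101001 are overlaps; in 0010011 the two blocks
  00 start at positions of different parity, but equal neighbours start only at odd positions of the
  Thue--Morse word.\<close>

lemma connector_not_factor:
  "list_all (\<lambda>p. list_all (\<lambda>s. \<not> agree 7 p s) factors17) connectors"
  by code_simp

lemma cubefreeI:
  assumes "\<And>i x. x > 0 \<Longrightarrow> i + 3 * x \<le> length w \<Longrightarrow> \<exists>j<2 * x. w ! (i + j) \<noteq> w ! (i + j + x)"
  shows "cubefree w"
  unfolding cubefree_def is_cube_def
proof (intro allI impI notI)
  fix u
  assume "sublist u w" and "\<exists>x. x \<noteq> [] \<and> u = x @ x @ x"
  then obtain x ps ss where x: "x \<noteq> []" and w: "w = ps @ (x @ x @ x) @ ss"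
    by (auto simp: sublist_def)
  have "w ! (length ps + j) = w ! (length ps + j + length x)" if "j < 2 * length x" for j
    using that by (auto simp: w nth_append add.assoc)
  moreover have "\<exists>j<2 * length x. w ! (length ps + j) \<noteq> w ! (length ps + j + length x)"
    using assms [of "length x" "length ps"] x by (simp add: w)
  ultimately show False by blast
qed

lemma cubefree_if_avoids_cubes:
  assumes "list_all (\<lambda>x. avoids_cubes x w) [1..<Suc (length w div 3)]"
  shows "cubefree w"
proof (rule cubefreeI)
  fix i x :: nat
  assume "x > 0" and le: "i + 3 * x \<le> length w"
  then have "x \<in> set [1..<Suc (length w div 3)]" by auto
  then have "avoids_cubes x w" using assms by (auto simp: list_all_iff)
  then show "\<exists>j<2 * x. w ! (i + j) \<noteq> w ! (i + j + x)"
    using avoids_cubesD \<open>x > 0\<close> le by blast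
qed

definition connected :: "nat \<Rightarrow> bool list \<Rightarrow> bool list" where
  "connected n p = p @ tm_factor 0 (n - length p)"

text \<open>The test on \<open>length p\<close> guards the truncated subtraction in
  \<open>connected\<close>; for n < 7 only the empty word passes it.\<close>

lemma small_squares:
  "list_all (\<lambda>n. list_ex (\<lambda>p.
      if length p \<le> n then
        (let w = connected n p @ connected n p in
          list_all (\<lambda>x. avoids_cubes x w) [1..<Suc (length w div 3)])
      else False) ([] # connectors)) [1..<32]"
  by code_simp

section \<open>Long squares\<close>

text \<open>The last 17 letters of u, which has length n - 7, start at n - 24.\<close>

locale connected_word =
  fixes n :: nat and p :: "bool list"
  assumes n: "n \<ge> 32"
    and p: "p \<in> set connectors"
    and fits: "fits (tm_factor (n - 24) 17) p"
begin

definition cyc :: "nat \<Rightarrow> bool" where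
  "cyc k = (if k mod n < 7 then p ! (k mod n) else thue_morse (k mod n - 7))"

definition window :: "bool list" where
  "window = tm_factor (n - 24) 17 @ p @ tm_factor 0 17"

lemma length_p [simp]: "length p = 7"
  using p by (auto simp: connectors_def)

lemma cyc_add_n [simp]: "cyc (k + n) = cyc k" "cyc (n + k) = cyc k"
  by (simp_all add: cyc_def)

lemma cyc_mod [simp]: "cyc (k mod n + j) = cyc (k + j)"
  unfolding cyc_def by (simp add: mod_simps)

lemma cyc_p: "n dvd k \<Longrightarrow> j < 7 \<Longrightarrow> cyc (k + j) = p ! j"
  using n by (auto simp: cyc_def elim!: dvdE)

lemma cyc_tm: "7 \<le> k \<Longrightarrow> k < n \<Longrightarrow> cyc k = thue_morse (k - 7)"
  by (simp add: cyc_def)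

lemma nth_window: "k < 41 \<Longrightarrow> window ! k = cyc (n - 17 + k)"
proof -
  assume k: "k < 41"
  consider "k < 17" | "17 \<le> k" "k < 24" | "24 \<le> k" by linarith
  then show ?thesis
  proof cases
    case 1
    then have "n - 17 + k - 7 = n - 24 + k" using n by simp
    then show ?thesis using 1 n cyc_tm [of "n - 17 + k"]
      by (simp add: window_def nth_append)
  next
    case 2
    then have "cyc (n - 17 + k) = cyc (n + (k - 17))" using n by simp
    also have "\<dots> = p ! (k - 17)" using 2 cyc_p [of n "k - 17"] by simp
    finally show ?thesis using 2 by (auto simp: window_def nth_append)
  next
    case 3
    then have "cyc (n - 17 + k) = cyc (n + (k - 17))" using n by simp
    also have "\<dots> = thue_morse (k - 24)" unfolding cyc_add_n using 3 k n cyc_tm [of "k - 17"] by simp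
    finally show ?thesis using 3 k by (auto simp: window_def nth_append)
  qed
qed

lemma length_window: "length window = 41"
  by (simp add: window_def)

section \<open>Occurrences of the connecting word\<close>

lemma
  shows avoids_left: "avoids_word p (tm_factor (n - 24) 17 @ butlast p)"
    and avoids_right: "avoids_word p (tl p @ tm_factor 0 17)"
    and avoids_short_cubes: "0 < x \<Longrightarrow> x < 7 \<Longrightarrow> avoids_cubes x window"
  using fits by (auto simp: fits_def window_def list_all_iff split: if_splits)

lemma occurrence_window:
  assumes "k \<le> 34" "\<And>j. j < 7 \<Longrightarrow> window ! (k + j) = p ! j"
  shows "k = 17"
proof (rule ccontr)
  assume "k \<noteq> 17"
  then consider "k < 17" | "k > 17" by linarith
  then show False
  proof cases
    case 1
    let ?l = "tm_factor (n - 24) 17 @ butlast p"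
    have "\<exists>j<7. ?l ! (k + j) \<noteq> p ! j"
      using avoids_wordD [OF avoids_left, of k] 1 length_p by fastforce
    moreover have "?l ! (k + j) = window ! (k + j)" if "j < 7" for j
      using 1 that by (auto simp: window_def nth_append nth_butlast)
    ultimately show False using assms(2) by auto
  next
    case 2
    let ?r = "tl p @ tm_factor 0 17"
    have "\<exists>j<7. ?r ! (k - 18 + j) \<noteq> p ! j"
      using avoids_wordD [OF avoids_right, of "k - 18"] assms(1) 2 length_p by fastforce
    moreover have "?r ! (k - 18 + j) = window ! (k + j)" if "j < 7" for j
    proof -
      have "Suc (k - 18 + j) = k + j - 17" "k - 18 + j - 6 = k + j - 24" using 2 by auto
      then show ?thesis using 2 by (auto simp: window_def nth_append nth_tl)
    qed
    ultimately show False using assms(2) by auto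
  qed
qed

lemma p_not_tm_factor: "p \<noteq> tm_factor i 7"
proof
  assume "p = tm_factor i 7"
  then have "agree 7 p (tm_factor i 17)"
    by (simp add: agree_iff)
  moreover have "\<not> agree 7 p (tm_factor i 17)"
    using connector_not_factor p tm_factor_17 by (auto simp: list_all_iff)
  ultimately show False by blast
qed

text \<open>Modulo n, an occurrence near a seam lies in the window, where p occurs only once; any
  other lies in u, where p does not occur.\<close>

lemma dvd_if_occurrence:
  assumes occ: "\<And>j. j < 7 \<Longrightarrow> cyc (k + j) = p ! j"
  shows "n dvd k"
proof -
  define r where "r = k mod n"
  have r: "r < n" and occ_r: "\<And>j. j < 7 \<Longrightarrow> cyc (r + j) = p ! j"
    using n occ by (auto simp: r_def)
  consider "r < 7" | "7 \<le> r" "r + 7 \<le> n" | "n < r + 7" by linarith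
  then have "r = 0"
  proof cases
    case 1
    have "window ! (17 + r + j) = p ! j" if "j < 7" for j
    proof -
      have "n - 17 + (17 + r + j) = n + (r + j)" using n by simp
      then show ?thesis using nth_window [of "17 + r + j"] 1 that occ_r by simp
    qed
    then have "17 + r = 17" using 1 by (intro occurrence_window) auto
    then show ?thesis by simp
  next
    case 2
    have "p = tm_factor (r - 7) 7"
    proof (rule nth_equalityI)
      fix j assume "j < length p"
      then show "p ! j = tm_factor (r - 7) 7 ! j"
        using 2 occ_r [of j] cyc_tm [of "r + j"] by simp
    qed simp
    then show ?thesis using p_not_tm_factor by blast
  next
    case 3
    define k' where "k' = r - (n - 17)"
    have k': "n - 17 + k' = r" "k' \<noteq> 17" "k' \<le> 34" using 3 r n by (auto simp: k'_def)
    have "window ! (k' + j) = p ! j" if "j < 7" for j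
      using nth_window [of "k' + j"] occ_r that k' 3 r n by (simp add: add.assoc [symmetric])
    then show ?thesis using k' occurrence_window by blast
  qed
  then show ?thesis by (auto simp: r_def)
qed

section \<open>Excluding cubes\<close>

lemma no_overlap:
  assumes "x > 0" "m * n + 7 \<le> a" "a + 2 * x < m * n + n"
    and "\<And>j. j \<le> x \<Longrightarrow> cyc (a + j) = cyc (a + j + x)"
  shows False
proof (rule thue_morse_overlap_free)
  fix j assume j: "j \<le> x"
  \<comment> \<open>These positions carry the copy of u in the block starting at m * n.\<close>
  have eq: "cyc k = thue_morse (k - m * n - 7)" if k: "m * n + 7 \<le> k" "k < m * n + n" for k
  proof -
    have "cyc (k - m * n + m * n) = cyc (k - m * n)"
      by (simp only: cyc_def mod_mult_self1)
    then have "cyc k = cyc (k - m * n)"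
      using k by simp
    then show ?thesis using k cyc_tm [of "k - m * n"] by simp
  qed
  have "a + j - m * n - 7 = a - m * n - 7 + j" "a + j + x - m * n - 7 = a - m * n - 7 + j + x"
    using assms(2) by auto
  then show "thue_morse (a - m * n - 7 + j) = thue_morse (a - m * n - 7 + j + x)"
    using assms(2,3) assms(4) [OF j] eq [of "a + j"] eq [of "a + j + x"] j by simp
qed fact

lemma no_short_cube:
  assumes x: "0 < x" "x < 7" and cube: "\<And>j. j < 2 * x \<Longrightarrow> cyc (i + j) = cyc (i + j + x)"
  shows False
proof -
  define r where "r = i mod n"
  have r: "r < n" using n by (simp add: r_def)
  have cube_r: "cyc (r + j) = cyc (r + j + x)" if "j < 2 * x" for j
    using cube [OF that] by (simp add: r_def add.assoc)
  have no_window: False if "k + 3 * x \<le> 41" "\<And>j. cyc (n - 17 + k + j) = cyc (r + j)" for k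
  proof -
    have "window ! (k + j) = window ! (k + j + x)" if "j < 2 * x" for j
    proof -
      have "window ! (k + j) = cyc (r + j)" "window ! (k + j + x) = cyc (r + j + x)"
        using nth_window [of "k + j"] nth_window [of "k + j + x"] \<open>k + 3 * x \<le> 41\<close> \<open>j < 2 * x\<close>
          \<open>\<And>j. cyc (n - 17 + k + j) = cyc (r + j)\<close>
        by (simp_all add: add.assoc)
      then show ?thesis using cube_r that by simp
    qed
    then show False
      using avoids_cubesD [OF avoids_short_cubes [OF x] x(1), of k] that(1) length_window by auto
  qed
  consider "r < 7" | "7 \<le> r" "r + 3 * x \<le> n" | "n < r + 3 * x" by linarith
  then show False
  proof cases
    case 1
    have "cyc (n - 17 + (17 + r) + j) = cyc (r + j)" for j
    proof -
      have "n - 17 + (17 + r) + j = n + (r + j)" using n by simp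
      then show ?thesis by (simp only: cyc_add_n)
    qed
    then show False using no_window [of "17 + r"] 1 x by simp
  next
    case 2
    then show False using no_overlap [of x 0 r] x cube_r by simp
  next
    case 3
    \<comment> \<open>Since 3x \<le> 18, r is at least n - 17 and the subtraction is not
      truncated.\<close>
    then have "n - 17 + (r - (n - 17)) = r" using n x by simp
    moreover have "r - (n - 17) + 3 * x \<le> 41" using r x by linarith
    ultimately show False using no_window [of "r - (n - 17)"] by simp
  qed
qed

text \<open>Shift the copy of p back by x, or forward if it starts in the first third; 7 \<le> x
  keeps it inside the cube. Then n divides x, although 0 < 3x \<le> 2n.\<close>

lemma no_connector_in_cube:
  assumes x: "7 \<le> x" "i + 3 * x \<le> 2 * n"
    and cube: "\<And>j. j < 2 * x \<Longrightarrow> cyc (i + j) = cyc (i + j + x)"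
    and k: "n dvd k" "i \<le> k" "k + 7 \<le> i + 3 * x"
  shows False
proof -
  have "n dvd x"
  proof (cases "i + x \<le> k")
    case True
    have "cyc (k - x + j) = p ! j" if "j < 7" for j
      using cube [of "k - x + j - i"] True k x that cyc_p [of k j] by simp
    then have "n dvd k - x" by (rule dvd_if_occurrence)
    then show ?thesis using k True by (metis add_leD2 dvd_diff_nat diff_diff_cancel)
  next
    case False
    have "cyc (k + x + j) = p ! j" if "j < 7" for j
      using cube [of "k + j - i"] False k x that cyc_p [of k j] by (simp add: ac_simps)
    then have "n dvd k + x" by (rule dvd_if_occurrence)
    then show ?thesis using k by (simp add: dvd_add_right_iff)
  qed
  then have "n \<le> x" using x by (intro dvd_imp_le) auto
  then show False using x by simp
qed

lemma no_long_cube: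
  assumes x: "7 \<le> x" "i + 3 * x \<le> 2 * n"
    and cube: "\<And>j. j < 2 * x \<Longrightarrow> cyc (i + j) = cyc (i + j + x)"
  shows False
proof -
  note no_p = no_connector_in_cube [OF x cube]
  have sub: False if "i \<le> a" "m * n + 7 \<le> a" "a + 2 * x < m * n + n" "a + 2 * x < i + 3 * x" for a m
  proof (rule no_overlap [of x m a])
    fix j assume "j \<le> x"
    then show "cyc (a + j) = cyc (a + j + x)"
      using cube [of "a + j - i"] that by simp
  qed (use x that in auto)
  show False
  proof (cases "n \<le> i")
    case True
    have "i \<noteq> n" using no_p [of n] x by auto
    then show False
      using True x by (intro sub [of "max i (n + 7)" 1]) auto
  next
    case False
    have "i \<noteq> 0" using no_p [of 0] x by auto
    moreover have "i + 3 * x \<le> n + 6" using no_p [of n] False by fastforce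
    \<comment> \<open>The bound on n comes from i = 1 and start 7: there 3x \<le> n + 5 must force
      2x + 7 < n, which it does from n = 32 on.\<close>
    ultimately show False
      using x n by (intro sub [of "max i 7" 0]) auto
  qed
qed

lemma cubefree_connected: "cubefree (connected n p @ connected n p)"
proof (rule cubefreeI)
  let ?w = "connected n p @ connected n p"
  fix i x :: nat
  assume x: "x > 0" "i + 3 * x \<le> length ?w"
  have len: "length (connected n p) = n" using n by (simp add: connected_def)
  have w: "?w ! k = cyc k" if "k < 2 * n" for k
  proof -
    have "connected n p ! k = cyc k" if "k < n" for k
      using that by (simp add: connected_def cyc_def nth_append)
    note nth = this
    show ?thesis
    proof (cases "k < n")
      case True
      then show ?thesis by (simp add: nth_append len nth)
    next
      case False
      then have "?w ! k = cyc (k - n)" using that by (simp add: nth_append len nth)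
      also have "\<dots> = cyc k" using False cyc_add_n(1) [of "k - n"] by simp
      finally show ?thesis .
    qed
  qed
  show "\<exists>j<2 * x. ?w ! (i + j) \<noteq> ?w ! (i + j + x)"
  proof (rule ccontr)
    assume "\<not> ?thesis"
    then have cube: "cyc (i + j) = cyc (i + j + x)" if "j < 2 * x" for j
      using that x w [of "i + j"] w [of "i + j + x"] len by auto
    show False
      using no_short_cube [OF _ _ cube] no_long_cube [OF _ _ cube] x len
      by (cases "x < 7") auto
  qed
qed

end

theorem theorem1:
  fixes n :: nat
  assumes "n > 0"
  shows "\<exists>s :: bool list. is_square s \<and> cubefree s \<and> length s = 2 * n"
proof -
  obtain p where len: "length p \<le> n" and cf: "cubefree (connected n p @ connected n p)"
  proof (cases "n < 32")
    case True
    then have "n \<in> set [1..<32]" using assms by auto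
    then obtain p where "length p \<le> n"
      "list_all (\<lambda>x. avoids_cubes x (connected n p @ connected n p))
         [1..<Suc (length (connected n p @ connected n p) div 3)]"
      using small_squares unfolding list_all_iff [of _ "[1..<32]"] list_ex_iff Let_def
      by (meson if_bool_eq_conj)
    then show thesis using that cubefree_if_avoids_cubes by blast
  next
    case False
    obtain p where "p \<in> set connectors" "fits (tm_factor (n - 24) 17) p"
      using connector_fits tm_factor_17 [of "n - 24"] by (auto simp: list_all_iff list_ex_iff)
    then interpret connected_word n p using False by unfold_locales auto
    show thesis using that [of p] cubefree_connected False by simp
  qed
  have "connected n p \<noteq> []" "length (connected n p) = n"
    using assms len by (auto simp: connected_def tm_factor_def)
  then show ?thesis
    using cf by (intro exI [of _ "connected n p @ connected n p"]) (auto simp: is_square_def)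
qed

end
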